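(* Let $p$ be an odd prime, $q\in\mathbb{C}_p$ with $|1-q|_p<p^{-1/(p-1)}$, $n\in\mathbb{Z}_+$ and $\alpha\in\mathbb{N}$. Then for every $x\in\mathbb{Z}_p$, $$\widetilde{\beta}_{n,q^{-1}}^{(\alpha)}(1-x)=(-1)^nq^{\alpha n}\widetilde{\beta}_{n,q}^{(\alpha)}(x).$$
   Context: For $r\in\mathbb{C}_p$ with $|1-r|_p<p^{-1/(p-1)}$ (e.g. $r=q$ or $r=q^{-1}$): $r^x=\exp(x\log r)$ for $x\in\mathbb{Z}_p$, $[x]_r=\frac{1-r^x}{1-r}$, and for uniformly differentiable $f:\mathbb{Z}_p\to\mathbb{C}_p$, $\int_{\mathbb{Z}_p}f(y)\,d\mu_r(y)=\lim_{N\to\infty}\frac{1}{[p^N]_r}\sum_{y=0}^{p^N-1}f(y)r^y$. Define $\widetilde{\beta}_{n,r}^{(\alpha)}(x)=\int_{\mathbb{Z}_p}[x+y]_{r^\alpha}^n\,d\mu_r(y)$. *)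

theory Defs
  imports "HOL-Analysis.Analysis" "HOL-Computational_Algebra.Computational_Algebra"
begin

text \<open>
  The libraries contain no \<open>p\<close>-adic fields, and a type cannot depend on the number \<open>p\<close>. The field
  \<open>\<complex>\<^sub>p\<close> is therefore given as a locale that spells out its usual description, determining it up to
  isometric isomorphism: a completion (complete, with dense image) of an algebraic closure of a
  completion of \<open>\<rat>\<close> for the \<open>p\<close>-adic absolute value. Inside the complete field \<open>\<complex>\<^sub>p\<close>, the completion
  \<open>\<rat>\<^sub>p\<close> of \<open>\<rat>\<close> is the topological closure of \<open>\<rat>\<close>.
\<close>

definition Qp :: "'a::{field_char_0, metric_space} set" where
  "Qp = closure (range of_rat)"

definition Qp_alg :: "'a::{field_char_0, metric_space} set" where
  "Qp_alg = {x. \<exists>f. f \<noteq> 0 \<and> (\<forall>i. coeff f i \<in> Qp) \<and> poly f x = 0}"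

text \<open>
  Multiplicativity, the ultrametric inequality and the normalisation \<open>\<bar>p\<bar> = 1/p\<close> force the
  restriction of the absolute value to \<open>\<rat>\<close> to be the \<open>p\<close>-adic one; definiteness comes from
  \<open>dist_eq\<close> and the metric axioms. Metric completeness is the class \<open>complete_space\<close>.
\<close>

locale padic_complex_field =
  fixes p :: nat and abs_p :: "'a::{field_char_0, complete_space} \<Rightarrow> real"
  assumes prime_p: "prime p"
    and dist_eq: "dist x y = abs_p (x - y)"
    and abs_mult: "abs_p (x * y) = abs_p x * abs_p y"
    and abs_ultrametric: "abs_p (x + y) \<le> max (abs_p x) (abs_p y)"
    and abs_of_p: "abs_p (of_nat p) = 1 / real p"
    and Qp_alg_closed:
      "degree (f :: 'a poly) > 0 \<Longrightarrow> (\<forall>i. coeff f i \<in> Qp_alg) \<Longrightarrow> \<exists>z\<in>Qp_alg. poly f z = 0"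
    and Qp_alg_dense: "closure Qp_alg = (UNIV :: 'a set)"

definition Zp :: "('a::{field_char_0, metric_space} \<Rightarrow> real) \<Rightarrow> 'a set" where
  "Zp abs_p = {x \<in> Qp. abs_p x \<le> 1}"

definition padic_exp :: "'a::{field_char_0, metric_space} \<Rightarrow> 'a" where
  "padic_exp z = (\<Sum>k. z ^ k / fact k)"

definition padic_log :: "'a::{field_char_0, metric_space} \<Rightarrow> 'a" where
  "padic_log r = (\<Sum>k. (-1) ^ k * (r - 1) ^ Suc k / of_nat (Suc k))"

definition padic_power :: "'a::{field_char_0, metric_space} \<Rightarrow> 'a \<Rightarrow> 'a" where
  "padic_power r x = padic_exp (x * padic_log r)"

text \<open>At \<open>r = 1\<close> the quotient is read as its limit \<open>[x]\<^sub>1 = x\<close>.\<close>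

definition q_number :: "'a::{field_char_0, metric_space} \<Rightarrow> 'a \<Rightarrow> 'a" where
  "q_number r x = (if r = 1 then x else (1 - padic_power r x) / (1 - r))"

text \<open>
  Only the values of \<open>f\<close> on \<open>\<nat> \<subseteq> \<int>\<^sub>p\<close> enter the integral. As for any use of \<open>lim\<close>, the value is
  meaningful when the limit exists, in particular for uniformly differentiable \<open>f\<close>.
\<close>

definition q_integral :: "nat \<Rightarrow> 'a::{field_char_0, metric_space} \<Rightarrow> ('a \<Rightarrow> 'a) \<Rightarrow> 'a" where
  "q_integral p r f =
     lim (\<lambda>N. 1 / q_number r (of_nat (p ^ N)) * (\<Sum>y = 0..<p ^ N. f (of_nat y) * r ^ y))"

definition weighted_q_bernoulli ::
    "nat \<Rightarrow> nat \<Rightarrow> nat \<Rightarrow> 'a::{field_char_0, metric_space} \<Rightarrow> 'a \<Rightarrow> 'a" where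
  "weighted_q_bernoulli p \<alpha> n r x = q_integral p r (\<lambda>y. q_number (r ^ \<alpha>) (x + y) ^ n)"

end

theory Submission imports Defs begin

text \<open>
  For \<open>q \<noteq> 1\<close> expand \<open>[x + y]\<^sup>n\<close> by the binomial theorem: both integrals become finite sums of
  integrals of powers \<open>q\<^bsup>\<alpha>ky\<^esup>\<close>, which are geometric sums with explicit limits, and the two closed
  forms agree term by term. For \<open>q = 1\<close> the integral is a limit of normalised power sums, and
  reversing the order of summation turns \<open>1 - x\<close> into \<open>x - p\<^sup>N\<close>, which tends to \<open>x\<close>.
  The analytic input, \<open>exp (log r) = r\<close> together with the functional equations of \<open>exp\<close> and \<open>log\<close>,
  comes from \<open>log r = lim (r\<^bsup>p^N\<^esup> - 1) / p\<^sup>N\<close>.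
\<close>

context padic_complex_field
begin

subsection \<open>The ultrametric absolute value\<close>

lemma p_gt_1: "p > 1"
  using prime_p prime_gt_1_nat by blast

lemma abs_eq_dist: "abs_p x = dist x 0"
  by (simp add: dist_eq)

lemma abs_0 [simp]: "abs_p 0 = 0"
  and abs_nonneg [simp]: "abs_p x \<ge> 0"
  and abs_eq_0_iff [simp]: "abs_p x = 0 \<longleftrightarrow> x = 0"
  and abs_gt_0_iff [simp]: "abs_p x > 0 \<longleftrightarrow> x \<noteq> 0"
  by (simp_all add: abs_eq_dist)

lemma abs_minus [simp]: "abs_p (- x) = abs_p x"
  using dist_eq[of 0 x] dist_eq[of x 0] by (simp add: dist_commute)

lemma abs_diff_commute: "abs_p (x - y) = abs_p (y - x)"
  using abs_minus[of "x - y"] by simp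

lemma abs_1 [simp]: "abs_p 1 = 1"
  using abs_mult[of 1 1] abs_eq_0_iff[of 1] by (metis mult_cancel_right1 mult_1 one_neq_zero)

lemma abs_power: "abs_p (x ^ n) = abs_p x ^ n"
  by (induction n) (auto simp: abs_mult)

lemma abs_inverse: "abs_p (inverse x) = inverse (abs_p x)"
proof (cases "x = 0")
  case False
  then have "abs_p x * abs_p (inverse x) = 1"
    by (simp flip: abs_mult)
  then show ?thesis
    by (metis inverse_unique)
qed auto

lemma abs_divide: "abs_p (x / y) = abs_p x / abs_p y"
  by (simp add: divide_inverse abs_mult abs_inverse)

lemma abs_diff_le: "abs_p (x - y) \<le> max (abs_p x) (abs_p y)"
  using abs_ultrametric[of x "- y"] by simp

lemma abs_add_leI: "abs_p x \<le> B \<Longrightarrow> abs_p y \<le> B \<Longrightarrow> abs_p (x + y) \<le> B"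
  using abs_ultrametric[of x y] by simp

lemma abs_diff_trans:
  "abs_p (x - y) \<le> B \<Longrightarrow> abs_p (y - z) \<le> B \<Longrightarrow> abs_p (x - z) \<le> B"
  using abs_add_leI[of "x - y" B "y - z"] by simp

lemma abs_sum_le:
  assumes "\<And>i. i \<in> A \<Longrightarrow> abs_p (f i) \<le> B" "B \<ge> 0"
  shows "abs_p (sum f A) \<le> B"
  using assms(1)
  by (induction A rule: infinite_finite_induct) (auto simp: assms(2) intro!: abs_add_leI)

lemma abs_eq_of_dominated: "abs_p (x - y) < abs_p y \<Longrightarrow> abs_p x = abs_p y"
  using abs_ultrametric[of "x - y" y] abs_diff_le[of x "x - y"] by simp

lemma abs_of_nat_le: "abs_p (of_nat n) \<le> 1"
  by (induction n) (auto intro!: abs_add_leI)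

lemma abs_of_int_le: "abs_p (of_int n) \<le> 1"
  using abs_of_nat_le[of "nat \<bar>n\<bar>"] abs_minus[of "of_int n"] by (cases "n \<ge> 0") auto

lemma abs_of_nat_p_power: "abs_p (of_nat (p ^ N)) = (1 / real p) ^ N"
  by (simp add: abs_power abs_of_p)

lemma abs_of_nat_coprime:
  assumes "\<not> p dvd n"
  shows "abs_p (of_nat n) = 1"
proof (rule antisym[OF abs_of_nat_le leI], rule notI)
  assume lt: "abs_p (of_nat n) < 1"
  have "coprime (int p) (int n)"
    using prime_imp_coprime[OF prime_p assms] by simp
  then obtain a b where ab: "a * int p + b * int n = 1"
    by (metis bezout_int coprime_iff_gcd_eq_1)
  have "abs_p (of_int (a * int p)) \<le> abs_p (of_nat p)"
    using abs_of_int_le[of a] by (simp add: abs_mult mult_left_le_one_le)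
  moreover have "abs_p (of_nat p) < 1"
    using p_gt_1 by (simp add: abs_of_p)
  moreover have "abs_p (of_int (b * int n)) \<le> abs_p (of_nat n)"
    using abs_of_int_le[of b] by (simp add: abs_mult mult_left_le_one_le)
  moreover have "abs_p (of_int (a * int p) + of_int (b * int n)) = 1"
    using ab by (metis abs_1 of_int_1 of_int_add)
  ultimately show False
    using lt abs_ultrametric[of "of_int (a * int p)" "of_int (b * int n)"] by simp
qed

definition inv_radius :: real where
  "inv_radius = real p powr (1 / (real p - 1))"

lemma inv_radius_ge_1: "inv_radius \<ge> 1"
  unfolding inv_radius_def using p_gt_1 by (intro ge_one_powr_ge_zero) auto

lemma inv_radius_power: "inv_radius ^ (p - 1) = real p"
  unfolding inv_radius_def using p_gt_1
  by (subst powr_realpow[symmetric]) (auto simp: powr_powr of_nat_diff)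

lemma less_radius_iff:
  "a < real p powr (- 1 / (real p - 1)) \<longleftrightarrow> a * inv_radius < 1"
proof -
  have "real p powr (- 1 / (real p - 1)) = 1 / inv_radius"
    by (simp add: inv_radius_def powr_minus_divide)
  then show ?thesis
    using inv_radius_ge_1 by (simp add: pos_less_divide_eq)
qed

lemma abs_less_1: "abs_p z * inv_radius < 1 \<Longrightarrow> abs_p z < 1"
  using inv_radius_ge_1 mult_left_mono[of 1 inv_radius "abs_p z"] by simp

lemma abs_fact_div: "abs_p (fact k) = (1 / real p) ^ (k div p) * abs_p (fact (k div p))"
proof (induction k)
  case (Suc k)
  show ?case
  proof (cases "p dvd Suc k")
    case True
    define m where "m = k div p"
    have div: "Suc k div p = Suc m"
      using True m_def by (simp add: div_Suc dvd_eq_mod_eq_0)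
    have eq: "Suc k = p * Suc m"
      using True div by (metis dvd_mult_div_cancel)
    have "abs_p (fact (Suc k)) = abs_p (of_nat (Suc k)) * abs_p (fact k)"
      by (simp add: fact_Suc abs_mult)
    also have "abs_p (of_nat (Suc k)) = 1 / real p * abs_p (of_nat (Suc m))"
      unfolding eq of_nat_mult by (simp only: abs_mult abs_of_p)
    also have "\<dots> * abs_p (fact k) = (1 / real p) ^ Suc m * abs_p (fact (Suc m))"
      unfolding Suc.IH m_def[symmetric] by (simp add: fact_Suc abs_mult)
    finally show ?thesis
      unfolding div .
  next
    case False
    then have "Suc k div p = k div p"
      by (simp add: div_Suc dvd_eq_mod_eq_0)
    moreover have "abs_p (fact (Suc k)) = abs_p (fact k)"
      using abs_of_nat_coprime[OF False] by (simp add: fact_Suc abs_mult)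
    ultimately show ?thesis
      using Suc.IH by simp
  qed
qed auto

lemma abs_fact_ge: "1 \<le> abs_p (fact k) * inv_radius ^ (k - 1)"
proof (induction k rule: less_induct)
  case (less k)
  define m where "m = k div p"
  show ?case
  proof (cases "m = 0")
    case True
    then have "abs_p (fact k) = 1"
      using abs_fact_div[of k] by (simp add: m_def)
    then show ?thesis
      using inv_radius_ge_1 by simp
  next
    case False
    then have "m < k"
      using p_gt_1 unfolding m_def by (cases "k = 0") auto
    have "p * m \<le> k"
      unfolding m_def by simp
    moreover have "(p - 1) * m + (m - 1) = p * m - 1"
      using False p_gt_1 by (cases p; cases m) (auto simp: algebra_simps)
    ultimately have le: "(p - 1) * m + (m - 1) \<le> k - 1"
      by simp
    have "1 \<le> abs_p (fact m) * inv_radius ^ (m - 1)"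
      using less \<open>m < k\<close> .
    also have "\<dots> = (1 / real p) ^ m * abs_p (fact m) * (real p ^ m * inv_radius ^ (m - 1))"
      using p_gt_1 by (simp add: power_divide)
    also have "real p ^ m * inv_radius ^ (m - 1) = inv_radius ^ ((p - 1) * m + (m - 1))"
      by (simp only: power_add power_mult inv_radius_power)
    also have "(1 / real p) ^ m * abs_p (fact m) * \<dots> \<le> abs_p (fact k) * inv_radius ^ (k - 1)"
      unfolding abs_fact_div[of k] m_def[symmetric]
      by (intro mult_left_mono power_increasing le inv_radius_ge_1) auto
    finally show ?thesis .
  qed
qed

subsection \<open>Limits and series\<close>

text \<open>
  The type is not in the class \<open>real_normed_field\<close>, so the limit rules for the field operations
  have to be derived from the absolute value.
\<close>

lemma tendsto_iff_abs: "(f \<longlongrightarrow> l) F \<longleftrightarrow> ((\<lambda>i. abs_p (f i - l)) \<longlongrightarrow> 0) F"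
  by (subst tendsto_dist_iff) (simp add: dist_eq)

lemma abs_tendsto: "(f \<longlongrightarrow> l) F \<Longrightarrow> ((\<lambda>i. abs_p (f i)) \<longlongrightarrow> abs_p l) F"
  unfolding abs_eq_dist by (intro tendsto_intros)

lemma padic_tendsto_add:
  fixes f g :: "'b \<Rightarrow> 'a"
  assumes "(f \<longlongrightarrow> a) F" "(g \<longlongrightarrow> b) F"
  shows "((\<lambda>i. f i + g i) \<longlongrightarrow> a + b) F"
proof -
  have "((\<lambda>i. max (abs_p (f i - a)) (abs_p (g i - b))) \<longlongrightarrow> max 0 0) F"
    using assms unfolding tendsto_iff_abs by (intro tendsto_max)
  then have lim: "((\<lambda>i. max (abs_p (f i - a)) (abs_p (g i - b))) \<longlongrightarrow> 0) F"
    by simp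
  have "abs_p (f i + g i - (a + b)) \<le> max (abs_p (f i - a)) (abs_p (g i - b))" for i
    using abs_ultrametric[of "f i - a" "g i - b"] by (simp only: add_diff_add)
  then show ?thesis
    unfolding tendsto_iff_abs
    by (intro Lim_null_comparison[OF _ lim] always_eventually)
       (simp del: le_max_iff_disj)
qed

lemma padic_tendsto_mult:
  fixes f g :: "'b \<Rightarrow> 'a"
  assumes "(f \<longlongrightarrow> a) F" "(g \<longlongrightarrow> b) F"
  shows "((\<lambda>i. f i * g i) \<longlongrightarrow> a * b) F"
proof -
  have "((\<lambda>i. max (abs_p (f i) * abs_p (g i - b)) (abs_p (f i - a) * abs_p b))
          \<longlongrightarrow> max (abs_p a * 0) (0 * abs_p b)) F"
    using assms unfolding tendsto_iff_abs
    by (intro tendsto_max tendsto_mult tendsto_const abs_tendsto assms(1))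
  then have lim: "((\<lambda>i. max (abs_p (f i) * abs_p (g i - b)) (abs_p (f i - a) * abs_p b))
          \<longlongrightarrow> 0) F"
    by simp
  have "abs_p (f i * g i - a * b)
          \<le> max (abs_p (f i) * abs_p (g i - b)) (abs_p (f i - a) * abs_p b)" for i
  proof -
    have "f i * g i - a * b = f i * (g i - b) + (f i - a) * b"
      by (simp add: algebra_simps)
    then show ?thesis
      using abs_ultrametric[of "f i * (g i - b)" "(f i - a) * b"] by (simp add: abs_mult)
  qed
  then show ?thesis
    unfolding tendsto_iff_abs
    by (intro Lim_null_comparison[OF _ lim] always_eventually)
       (simp del: le_max_iff_disj)
qed

lemma padic_tendsto_diff:
  fixes f g :: "'b \<Rightarrow> 'a"
  shows "(f \<longlongrightarrow> a) F \<Longrightarrow> (g \<longlongrightarrow> b) F \<Longrightarrow> ((\<lambda>i. f i - g i) \<longlongrightarrow> a - b) F"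
  using padic_tendsto_add[of f a F "\<lambda>i. - 1 * g i" "- 1 * b"]
    padic_tendsto_mult[OF tendsto_const[of "- 1"], of g b F] by simp

lemma padic_tendsto_power:
  fixes f :: "'b \<Rightarrow> 'a"
  shows "(f \<longlongrightarrow> a) F \<Longrightarrow> ((\<lambda>i. f i ^ n) \<longlongrightarrow> a ^ n) F"
  by (induction n) (auto intro: padic_tendsto_mult)

lemma padic_tendsto_sum:
  fixes f :: "'c \<Rightarrow> 'b \<Rightarrow> 'a"
  shows   "(\<And>k. k \<in> A \<Longrightarrow> (f k \<longlongrightarrow> a k) F) \<Longrightarrow> ((\<lambda>i. \<Sum>k\<in>A. f k i) \<longlongrightarrow> (\<Sum>k\<in>A. a k)) F"
  by (induction A rule: infinite_finite_induct) (auto intro: padic_tendsto_add)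

lemmas padic_tendsto_intros =
  tendsto_const padic_tendsto_add padic_tendsto_diff padic_tendsto_mult padic_tendsto_power
  padic_tendsto_sum

lemma p_power_tendsto_0: "(\<lambda>N. of_nat (p ^ N) :: 'a) \<longlonglongrightarrow> 0"
  unfolding tendsto_iff_abs diff_zero abs_of_nat_p_power
  using p_gt_1 by (intro LIMSEQ_realpow_zero) auto

lemma sums_tail_le:
  assumes "f sums s" "\<And>k. k \<ge> m \<Longrightarrow> abs_p (f k) \<le> B" "B \<ge> 0"
  shows "abs_p (s - sum f {..<m}) \<le> B"
proof (rule Lim_bounded)
  show "(\<lambda>n. abs_p (sum f {..<n} - sum f {..<m})) \<longlonglongrightarrow> abs_p (s - sum f {..<m})"
    using assms(1) unfolding sums_def by (intro abs_tendsto padic_tendsto_intros)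
  show "\<forall>n\<ge>m. abs_p (sum f {..<n} - sum f {..<m}) \<le> B"
  proof (intro allI impI)
    fix n assume "n \<ge> m"
    then have "sum f {..<n} - sum f {..<m} = sum f ({..<n} - {..<m})"
      by (subst sum_diff) auto
    then show "abs_p (sum f {..<n} - sum f {..<m}) \<le> B"
      using assms by (auto intro!: abs_sum_le)
  qed
qed

lemma summable_if_null:
  assumes "(\<lambda>k. abs_p (f k)) \<longlonglongrightarrow> 0"
  shows "summable f"
proof -
  have "Cauchy (\<lambda>n. sum f {..<n})"
  proof (rule CauchyI')
    fix e :: real assume "e > 0"
    then obtain M where M: "\<And>k. k \<ge> M \<Longrightarrow> abs_p (f k) < e / 2"
      using order_tendstoD(2)[OF assms, of "e / 2"] by (auto simp: eventually_sequentially)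
    have "dist (sum f {..<m}) (sum f {..<n}) < e" if "m \<ge> M" "n > m" for m n
    proof -
      have "sum f {..<n} - sum f {..<m} = sum f ({..<n} - {..<m})"
        using that by (subst sum_diff) auto
      moreover have "abs_p (sum f ({..<n} - {..<m})) \<le> e / 2"
        using M that \<open>e > 0\<close> by (intro abs_sum_le) (auto intro!: less_imp_le)
      ultimately show ?thesis
        using \<open>e > 0\<close> by (simp add: dist_eq abs_diff_commute[of "sum f {..<m}"])
    qed
    then show "\<exists>M. \<forall>m\<ge>M. \<forall>n>m. dist (sum f {..<m}) (sum f {..<n}) < e"
      by blast
  qed
  then show ?thesis
    by (simp add: summable_iff_convergent Cauchy_convergent_iff)
qed

lemma summable_if_geometric:
  assumes "\<And>k. abs_p (f k) \<le> C * c ^ k" "\<bar>c\<bar> < 1"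
  shows "summable f"
proof (rule summable_if_null)
  have "(\<lambda>k. C * c ^ k) \<longlonglongrightarrow> C * 0"
    using assms(2) by (intro tendsto_mult tendsto_const LIMSEQ_abs_realpow_zero2)
  then have lim: "(\<lambda>k. C * c ^ k) \<longlonglongrightarrow> 0"
    by simp
  show "(\<lambda>k. abs_p (f k)) \<longlonglongrightarrow> 0"
    using assms(1) by (intro Lim_null_comparison[OF _ lim] always_eventually) simp
qed

subsection \<open>Powers and the logarithm\<close>

lemma abs_of_nat_Suc_ge: "1 \<le> abs_p (of_nat (Suc k)) * inv_radius ^ k"
proof -
  have "1 \<le> abs_p (of_nat (Suc k)) * abs_p (fact k) * inv_radius ^ k"
    using abs_fact_ge[of "Suc k"] by (simp add: fact_Suc abs_mult)
  also have "\<dots> \<le> abs_p (of_nat (Suc k)) * 1 * inv_radius ^ k"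
    using abs_of_nat_le[of "fact k"] inv_radius_ge_1
    by (intro mult_right_mono mult_left_mono) auto
  finally show ?thesis
    by simp
qed

lemma abs_power_divide_le:
  assumes "1 \<le> abs_p d * inv_radius ^ k"
  shows "abs_p (z ^ Suc k / d) \<le> abs_p z * (abs_p z * inv_radius) ^ k"
proof -
  have "d \<noteq> 0"
    using assms by auto
  moreover have "abs_p z ^ Suc k * 1 \<le> abs_p z ^ Suc k * (abs_p d * inv_radius ^ k)"
    by (intro mult_left_mono assms) auto
  ultimately show ?thesis
    by (simp add: abs_divide abs_power pos_divide_le_eq power_mult_distrib mult_ac del: power_Suc)
       (simp add: mult_ac)
qed

lemmas abs_log_term_le = abs_power_divide_le[OF abs_of_nat_Suc_ge]
lemmas abs_exp_term_le = abs_power_divide_le[OF abs_fact_ge[of "Suc k" for k, unfolded diff_Suc_1]]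

lemma abs_of_nat_log_term_le:
  "abs_p (of_nat m * (u ^ Suc k / of_nat (Suc k))) \<le> abs_p u * (abs_p u * inv_radius) ^ k"
proof -
  have "abs_p (of_nat m * (u ^ Suc k / of_nat (Suc k)))
      \<le> 1 * (abs_p u * (abs_p u * inv_radius) ^ k)"
    unfolding abs_mult[of "of_nat m"]
    by (intro mult_mono abs_of_nat_le abs_log_term_le) auto
  then show ?thesis
    by simp
qed

lemma geometric_term_mono:
  assumes "m \<le> k" "abs_p u * inv_radius < 1"
  shows "abs_p u * (abs_p u * inv_radius) ^ k \<le> abs_p u * (abs_p u * inv_radius) ^ m"
  using assms inv_radius_ge_1 by (intro mult_left_mono power_decreasing) auto

lemma one_plus_power_sums:
  fixes u :: 'a
  assumes "M > 0"
  shows "(\<lambda>k. of_nat ((M - 1) choose k) * (u ^ Suc k / of_nat (Suc k)))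
           sums (((1 + u) ^ M - 1) / of_nat M)"
proof -
  obtain m where m: "M = Suc m"
    using assms gr0_implies_Suc by blast
  have "of_nat M * (of_nat (m choose k) * (u ^ Suc k / of_nat (Suc k)))
      = of_nat (M choose Suc k) * u ^ Suc k" for k
  proof -
    have "of_nat (Suc k) * of_nat (M choose Suc k) = (of_nat M * of_nat (m choose k) :: 'a)"
      unfolding m of_nat_mult[symmetric] by (simp only: Suc_times_binomial)
    then have "of_nat M * of_nat (m choose k) / of_nat (Suc k) = (of_nat (M choose Suc k) :: 'a)"
      by (metis nonzero_mult_div_cancel_left of_nat_neq_0)
    moreover have "of_nat M * (of_nat (m choose k) * (u ^ Suc k / of_nat (Suc k)))
        = of_nat M * of_nat (m choose k) / of_nat (Suc k) * u ^ Suc k"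
      by (simp add: mult.assoc del: of_nat_Suc power_Suc)
    ultimately show ?thesis
      by (simp only:)
  qed
  then have "of_nat M * (\<Sum>k<M. of_nat (m choose k) * (u ^ Suc k / of_nat (Suc k)))
      = (\<Sum>k\<le>m. of_nat (M choose Suc k) * u ^ Suc k)"
    by (simp only: sum_distrib_left m lessThan_Suc_atMost)
  also have "\<dots> = (1 + u) ^ M - 1"
  proof -
    have "(u + 1) ^ M = (\<Sum>k\<le>Suc m. of_nat (M choose k) * u ^ k)"
      by (simp only: binomial_ring m power_one mult_1_right)
    then show ?thesis
      by (simp only: sum.atMost_Suc_shift) (simp add: add.commute del: power_Suc)
  qed
  finally have "(\<Sum>k<M. of_nat (m choose k) * (u ^ Suc k / of_nat (Suc k)))
      = ((1 + u) ^ M - 1) / of_nat M"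
    using assms by (metis m nonzero_mult_div_cancel_left of_nat_neq_0)
  moreover have "(\<lambda>k. of_nat (m choose k) * (u ^ Suc k / of_nat (Suc k)))
      sums (\<Sum>k<M. of_nat (m choose k) * (u ^ Suc k / of_nat (Suc k)))"
    by (intro sums_finite) (auto simp: m)
  ultimately show ?thesis
    by (simp add: m)
qed

lemma abs_one_plus_power:
  assumes "abs_p u * inv_radius < 1"
  shows "abs_p ((1 + u) ^ M - 1) = abs_p (of_nat M) * abs_p u"
proof (cases "M = 0 \<or> u = 0")
  case False
  have "abs_p (((1 + u) ^ M - 1) / of_nat M
          - (\<Sum>k<1. of_nat ((M - 1) choose k) * (u ^ Suc k / of_nat (Suc k))))
      \<le> abs_p u * (abs_p u * inv_radius) ^ 1"
    using False inv_radius_ge_1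
    by (intro sums_tail_le one_plus_power_sums
          order_trans[OF abs_of_nat_log_term_le geometric_term_mono] assms) auto
  also have "\<dots> < abs_p u"
    using assms False by simp
  finally have "abs_p (((1 + u) ^ M - 1) / of_nat M) = abs_p u"
    by (intro abs_eq_of_dominated) simp
  then show ?thesis
    using False by (simp add: abs_divide field_simps)
qed auto

lemma abs_power_minus_1:
  "abs_p (1 - r) * inv_radius < 1 \<Longrightarrow> abs_p (1 - r ^ M) = abs_p (of_nat M) * abs_p (1 - r)"
  using abs_one_plus_power[of "r - 1" M] by (simp add: abs_diff_commute)

lemma power_eq_1_iff_near_1:
  "abs_p (1 - r) * inv_radius < 1 \<Longrightarrow> M > 0 \<Longrightarrow> r ^ M = 1 \<longleftrightarrow> r = 1"
  using abs_power_minus_1[of r M] abs_eq_0_iff[of "1 - r ^ M"]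
  by (auto simp del: abs_eq_0_iff) (simp_all only: abs_eq_0_iff, simp_all)

lemma power_near_1:
  assumes "abs_p (1 - r) * inv_radius < 1"
  shows "abs_p (1 - r ^ M) * inv_radius < 1"
proof -
  have "abs_p (1 - r ^ M) \<le> abs_p (1 - r)"
    using abs_of_nat_le by (simp add: abs_power_minus_1[OF assms] mult_left_le_one_le)
  then show ?thesis
    using assms inv_radius_ge_1 by (meson le_less_trans mult_right_mono order_trans zero_le_one)
qed

lemma abs_near_1:
  assumes "abs_p (1 - r) * inv_radius < 1"
  shows "abs_p r = 1"
  using abs_eq_of_dominated[of r 1] abs_less_1[OF assms] by (simp add: abs_diff_commute)

lemma near_1_nonzero: "abs_p (1 - r) * inv_radius < 1 \<Longrightarrow> r \<noteq> 0"
  using abs_near_1 by fastforce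

lemma inverse_near_1:
  assumes "abs_p (1 - r) * inv_radius < 1"
  shows "abs_p (1 - inverse r) * inv_radius < 1"
proof -
  have "1 - inverse r = - (1 - r) / r"
    using near_1_nonzero[OF assms] by (simp add: field_simps)
  then show ?thesis
    using assms abs_near_1[OF assms] by (simp add: abs_divide del: minus_diff_eq)
qed

lemma mult_near_1:
  assumes "abs_p (1 - r) * inv_radius < 1" "abs_p (1 - s) * inv_radius < 1"
  shows "abs_p (1 - r * s) * inv_radius < 1"
proof -
  have eq: "1 - r * s = (1 - r) + r * (1 - s)"
    by (simp add: algebra_simps)
  have "abs_p (1 - r * s) \<le> max (abs_p (1 - r)) (abs_p (1 - s))"
    unfolding eq
    using abs_ultrametric[of "1 - r" "r * (1 - s)"] abs_near_1[OF assms(1)]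
    by (simp add: abs_mult)
  then have "abs_p (1 - r * s) * inv_radius \<le> max (abs_p (1 - r)) (abs_p (1 - s)) * inv_radius"
    using inv_radius_ge_1 by (intro mult_right_mono) auto
  then show ?thesis
    using assms by (auto simp: max_def split: if_splits)
qed

lemma power_p_power_tendsto_1:
  assumes "abs_p (1 - r) * inv_radius < 1"
  shows "(\<lambda>N. r ^ (p ^ N)) \<longlonglongrightarrow> 1"
proof -
  have "(\<lambda>N. abs_p (of_nat (p ^ N)) * abs_p (1 - r)) \<longlonglongrightarrow> abs_p 0 * abs_p (1 - r)"
    by (intro tendsto_mult tendsto_const abs_tendsto p_power_tendsto_0)
  then show ?thesis
    unfolding tendsto_iff_abs[of _ 1] abs_diff_commute[of _ 1] abs_power_minus_1[OF assms] by simp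
qed

lemma padic_log_sums:
  assumes "abs_p (1 - r) * inv_radius < 1"
  shows "(\<lambda>k. (-1) ^ k * (r - 1) ^ Suc k / of_nat (Suc k)) sums padic_log r"
proof -
  have "abs_p ((-1) ^ k * (r - 1) ^ Suc k / of_nat (Suc k))
      \<le> abs_p (r - 1) * (abs_p (r - 1) * inv_radius) ^ k" for k
    using abs_log_term_le[of "r - 1" k] by (simp add: abs_mult abs_divide abs_power)
  moreover have "\<bar>abs_p (r - 1) * inv_radius\<bar> < 1"
    using assms inv_radius_ge_1 by (simp add: abs_diff_commute)
  ultimately show ?thesis
    unfolding padic_log_def by (intro summable_sums summable_if_geometric)
qed

lemma binomial_p_power_tendsto:
  "(\<lambda>N. of_nat ((p ^ N - 1) choose k) :: 'a) \<longlonglongrightarrow> (-1) ^ k"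
proof (induction k)
  case (Suc k)
  have "(\<lambda>N. of_nat ((p ^ N - 1) choose k) * (of_nat (p ^ N) - of_nat (Suc k))
          / of_nat (Suc k) :: 'a)
      \<longlonglongrightarrow> (-1) ^ k * (0 - of_nat (Suc k)) / of_nat (Suc k)"
    unfolding divide_inverse by (intro padic_tendsto_intros Suc.IH p_power_tendsto_0)
  also have "(-1) ^ k * (0 - of_nat (Suc k)) / of_nat (Suc k) = ((-1) ^ Suc k :: 'a)"
    using of_nat_neq_0[of k, where ?'a = 'a] by (simp del: of_nat_Suc)
  also have "(\<lambda>N. of_nat ((p ^ N - 1) choose k) * (of_nat (p ^ N) - of_nat (Suc k))
          / of_nat (Suc k))
      = (\<lambda>N. of_nat ((p ^ N - 1) choose Suc k) :: 'a)"
  proof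
    fix N
    obtain m where m: "p ^ N = Suc m"
      using p_gt_1 by (metis Suc_pred zero_less_power zero_less_one less_trans)
    have "of_nat (m choose k) * (of_nat (Suc m) - of_nat (Suc k))
        = (of_nat (m choose Suc k) * of_nat (Suc k) :: 'a)"
    proof (cases "k \<le> m")
      case True
      have "(m choose Suc k) * Suc k = (m choose k) * (m - k)"
        using binomial_absorb_comp[of m k] binomial_absorption[of k m] by (simp add: mult_ac)
      then show ?thesis
        using True by (metis Suc_le_mono diff_Suc_Suc of_nat_diff of_nat_mult)
    qed (auto simp: binomial_eq_0)
    then show "of_nat ((p ^ N - 1) choose k) * (of_nat (p ^ N) - of_nat (Suc k)) / of_nat (Suc k)
        = (of_nat ((p ^ N - 1) choose Suc k) :: 'a)"
      unfolding m by (simp add: field_simps del: of_nat_Suc)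
  qed
  finally show ?case .
qed auto

lemma padic_log_limit:
  assumes "abs_p (1 - r) * inv_radius < 1"
  shows "(\<lambda>N. (r ^ (p ^ N) - 1) / of_nat (p ^ N)) \<longlonglongrightarrow> padic_log r"
proof -
  define u where "u = r - 1"
  have u: "abs_p u * inv_radius < 1" "r = 1 + u"
    using assms by (auto simp: u_def abs_diff_commute)
  define c where "c = abs_p u * inv_radius"
  have c: "0 \<le> c" "c < 1"
    using u inv_radius_ge_1 by (auto simp: c_def)
  define f where "f N k = of_nat ((p ^ N - 1) choose k) * (u ^ Suc k / of_nat (Suc k))" for N k
  define h where "h k = (-1) ^ k * (u ^ Suc k / of_nat (Suc k))" for k
  have f_tail: "abs_p ((r ^ (p ^ N) - 1) / of_nat (p ^ N) - sum (f N) {..<K}) \<le> abs_p u * c ^ K"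
    for N K
    unfolding u(2) f_def c_def using p_gt_1 inv_radius_ge_1
    by (intro sums_tail_le one_plus_power_sums
          order_trans[OF abs_of_nat_log_term_le geometric_term_mono] u) auto
  have h_tail: "abs_p (padic_log r - sum h {..<K}) \<le> abs_p u * c ^ K" for K
  proof (rule sums_tail_le)
    show "h sums padic_log r"
      using padic_log_sums[OF assms] by (simp only: h_def[abs_def] u_def times_divide_eq_right)
    show "abs_p (h k) \<le> abs_p u * c ^ K" if "k \<ge> K" for k
    proof -
      have "abs_p (h k) \<le> abs_p u * c ^ k"
        using abs_log_term_le[of u k] unfolding h_def c_def abs_mult[of "(- 1) ^ k"]
        by (simp only: abs_power abs_minus abs_1 power_one mult_1_left)
      also have "\<dots> \<le> abs_p u * c ^ K"
        unfolding c_def by (rule geometric_term_mono[OF that u(1)])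
      finally show ?thesis .
    qed
  qed (use c in auto)
  show ?thesis
  proof (rule metric_LIMSEQ_I)
    fix e :: real assume "e > 0"
    have "(\<lambda>K. abs_p u * c ^ K) \<longlonglongrightarrow> abs_p u * 0"
      using c by (intro tendsto_mult tendsto_const LIMSEQ_realpow_zero)
    then have "eventually (\<lambda>K. abs_p u * c ^ K < e) sequentially"
      by (rule order_tendstoD) (simp add: \<open>e > 0\<close>)
    then obtain K where K: "abs_p u * c ^ K < e"
      by (auto simp: eventually_sequentially)
    have "(\<lambda>N. sum (f N) {..<K}) \<longlonglongrightarrow> sum h {..<K}"
      unfolding f_def h_def by (intro padic_tendsto_intros binomial_p_power_tendsto)
    then obtain N0 where N0: "\<And>N. N \<ge> N0 \<Longrightarrow> abs_p (sum (f N) {..<K} - sum h {..<K}) < e"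
      using \<open>e > 0\<close> by (auto simp: lim_sequentially dist_eq)
    have "dist ((r ^ (p ^ N) - 1) / of_nat (p ^ N)) (padic_log r) < e" if "N \<ge> N0" for N
    proof -
      let ?B = "max (abs_p u * c ^ K) (abs_p (sum (f N) {..<K} - sum h {..<K}))"
      have "abs_p ((r ^ (p ^ N) - 1) / of_nat (p ^ N) - padic_log r) \<le> ?B"
      proof (rule abs_diff_trans)
        show "abs_p ((r ^ (p ^ N) - 1) / of_nat (p ^ N) - sum (f N) {..<K}) \<le> ?B"
          using f_tail[of N K] by (rule max.coboundedI1)
        have "abs_p (sum h {..<K} - padic_log r) \<le> ?B"
          unfolding abs_diff_commute[of "sum h {..<K}"] using h_tail[of K] by (rule max.coboundedI1)
        then show "abs_p (sum (f N) {..<K} - padic_log r) \<le> ?B"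
          by (rule abs_diff_trans[rotated]) (rule max.cobounded2)
      qed
      then show ?thesis
        using K N0[OF that] by (simp add: dist_eq)
    qed
    then show "\<exists>N0. \<forall>N\<ge>N0. dist ((r ^ (p ^ N) - 1) / of_nat (p ^ N)) (padic_log r) < e"
      by blast
  qed
qed

lemma padic_log_mult:
  assumes "abs_p (1 - r) * inv_radius < 1" "abs_p (1 - s) * inv_radius < 1"
  shows "padic_log (r * s) = padic_log r + padic_log s"
proof -
  let ?l = "\<lambda>r N. (r ^ (p ^ N) - 1) / of_nat (p ^ N)"
  have "(\<lambda>N. ?l r N * s ^ (p ^ N) + ?l s N) \<longlonglongrightarrow> padic_log r * 1 + padic_log s"
    by (intro padic_tendsto_intros padic_log_limit power_p_power_tendsto_1 assms)
  moreover have "?l r N * s ^ (p ^ N) + ?l s N = ?l (r * s) N" for N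
    by (simp add: power_mult_distrib add_divide_distrib[symmetric] left_diff_distrib)
  ultimately have "?l (r * s) \<longlonglongrightarrow> padic_log r + padic_log s"
    by simp
  then show ?thesis
    using padic_log_limit[OF mult_near_1[OF assms]] LIMSEQ_unique by blast
qed

lemma padic_log_1: "padic_log (1 :: 'a) = 0"
  using padic_log_mult[of 1 1] by simp

lemma padic_log_inverse:
  "abs_p (1 - r) * inv_radius < 1 \<Longrightarrow> padic_log (inverse r) = - padic_log r"
  using padic_log_mult[OF _ inverse_near_1, of r r] near_1_nonzero[of r]
  by (simp add: padic_log_1 eq_neg_iff_add_eq_0 add.commute)

lemma padic_log_power:
  assumes "abs_p (1 - r) * inv_radius < 1"
  shows "padic_log (r ^ n) = of_nat n * padic_log r"
  by (induction n) (simp_all add: assms padic_log_1 padic_log_mult power_near_1 distrib_right)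

lemma abs_padic_log_diff_le:
  assumes "abs_p (1 - r) * inv_radius < 1"
  shows "abs_p (padic_log r - (r - 1)) \<le> abs_p (1 - r) ^ 2 * inv_radius"
proof -
  have "abs_p (padic_log r - (\<Sum>k<1. (-1) ^ k * (r - 1) ^ Suc k / of_nat (Suc k)))
      \<le> abs_p (r - 1) * (abs_p (r - 1) * inv_radius) ^ 1"
  proof (rule sums_tail_le[OF padic_log_sums[OF assms]])
    fix k :: nat assume "k \<ge> 1"
    have "abs_p ((-1) ^ k * (r - 1) ^ Suc k / of_nat (Suc k))
        \<le> abs_p (r - 1) * (abs_p (r - 1) * inv_radius) ^ k"
      using abs_log_term_le[of "r - 1" k] by (simp add: abs_mult abs_divide abs_power)
    also have "\<dots> \<le> abs_p (r - 1) * (abs_p (r - 1) * inv_radius) ^ 1"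
      using assms by (intro geometric_term_mono \<open>k \<ge> 1\<close>) (simp add: abs_diff_commute)
    finally show "abs_p ((-1) ^ k * (r - 1) ^ Suc k / of_nat (Suc k)) \<le> \<dots>" .
  qed (use inv_radius_ge_1 in simp)
  then show ?thesis
    by (simp add: power2_eq_square abs_diff_commute[of r 1] mult_ac)
qed

lemma abs_padic_log_le:
  assumes "abs_p (1 - r) * inv_radius < 1"
  shows "abs_p (padic_log r) \<le> abs_p (1 - r)"
proof -
  have "abs_p (1 - r) * (abs_p (1 - r) * inv_radius) \<le> abs_p (1 - r) * 1"
    using assms by (intro mult_left_mono) auto
  then have "abs_p (padic_log r - (r - 1)) \<le> abs_p (1 - r)"
    using abs_padic_log_diff_le[OF assms] by (simp add: power2_eq_square mult_ac)
  then show ?thesis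
    using abs_add_leI[of "padic_log r - (r - 1)" "abs_p (1 - r)" "r - 1"]
    by (simp add: abs_diff_commute)
qed

lemma padic_log_small:
  assumes "abs_p (1 - r) * inv_radius < 1"
  shows "abs_p (padic_log r) * inv_radius < 1"
  by (rule le_less_trans[OF mult_right_mono[OF abs_padic_log_le[OF assms]] assms])
     (use inv_radius_ge_1 in simp)

subsection \<open>The exponential\<close>

lemma abs_exp_term_le': "abs_p (z ^ k / fact k) \<le> (abs_p z * inv_radius) ^ k"
proof (cases k)
  case (Suc j)
  have "abs_p z * (abs_p z * inv_radius) ^ j \<le> (abs_p z * inv_radius) * (abs_p z * inv_radius) ^ j"
    using inv_radius_ge_1 mult_left_mono[of 1 inv_radius "abs_p z"]
    by (intro mult_right_mono) auto
  then show ?thesis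
    using abs_exp_term_le[of z j] Suc by simp
qed auto

lemma padic_exp_sums:
  assumes "abs_p z * inv_radius < 1"
  shows "(\<lambda>k. z ^ k / fact k) sums padic_exp z"
  unfolding padic_exp_def
proof (intro summable_sums summable_if_geometric)
  show "abs_p (z ^ k / fact k) \<le> 1 * (abs_p z * inv_radius) ^ k" for k
    using abs_exp_term_le' by simp
  show "\<bar>abs_p z * inv_radius\<bar> < 1"
    using assms inv_radius_ge_1 by simp
qed

lemma padic_exp_0 [simp]: "padic_exp (0 :: 'a) = 1"
proof -
  have "(\<lambda>k. 0 ^ k / fact k) sums (\<Sum>k\<in>{0}. 0 ^ k / fact k :: 'a)"
    by (intro sums_finite) auto
  then show ?thesis
    using padic_exp_sums[of 0] sums_unique2 by fastforce
qed

lemma abs_padic_exp_diff_le: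
  assumes "abs_p z * inv_radius < 1"
  shows "abs_p (padic_exp z - (1 + z)) \<le> abs_p z ^ 2 * inv_radius"
proof -
  have "abs_p (padic_exp z - (\<Sum>k<2. z ^ k / fact k)) \<le> abs_p z * (abs_p z * inv_radius) ^ 1"
  proof (rule sums_tail_le[OF padic_exp_sums[OF assms]])
    fix k :: nat assume "k \<ge> 2"
    then obtain j where j: "k = Suc j" "j \<ge> 1"
      by (cases k) auto
    have "abs_p (z ^ k / fact k) \<le> abs_p z * (abs_p z * inv_radius) ^ j"
      unfolding j by (rule abs_exp_term_le)
    also have "\<dots> \<le> abs_p z * (abs_p z * inv_radius) ^ 1"
      using j assms by (intro geometric_term_mono)
    finally show "abs_p (z ^ k / fact k) \<le> \<dots>" .
  qed (use inv_radius_ge_1 in simp)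
  then show ?thesis
    by (simp add: power2_eq_square mult_ac numeral_2_eq_2)
qed

lemma padic_exp_near_1:
  assumes "abs_p z * inv_radius < 1"
  shows "abs_p (1 - padic_exp z) * inv_radius < 1"
proof -
  have "abs_p z * (abs_p z * inv_radius) \<le> abs_p z * 1"
    using assms by (intro mult_left_mono) auto
  then have "abs_p (padic_exp z - (1 + z)) \<le> abs_p z"
    using abs_padic_exp_diff_le[OF assms] by (simp add: power2_eq_square mult_ac)
  then have "abs_p (padic_exp z - 1) \<le> abs_p z"
    using abs_add_leI[of "padic_exp z - (1 + z)" "abs_p z" z] by (simp add: algebra_simps)
  then have "abs_p (1 - padic_exp z) * inv_radius \<le> abs_p z * inv_radius"
    using inv_radius_ge_1 by (intro mult_right_mono) (auto simp: abs_diff_commute)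
  then show ?thesis
    using assms by simp
qed

lemma padic_exp_add:
  assumes a: "abs_p a * inv_radius < 1" and b: "abs_p b * inv_radius < 1"
  shows "padic_exp (a + b) = padic_exp a * padic_exp b"
proof -
  define c where "c = max (abs_p a) (abs_p b) * inv_radius"
  have c: "0 \<le> c" "c < 1"
    using a b inv_radius_ge_1 by (auto simp: c_def max_def)
  have ab: "abs_p (a + b) * inv_radius < 1"
  proof -
    have "abs_p (a + b) * inv_radius \<le> c"
      unfolding c_def using inv_radius_ge_1 abs_ultrametric by (intro mult_right_mono) auto
    then show ?thesis
      using c by simp
  qed
  let ?E = "\<lambda>z K. \<Sum>k<K. z ^ k / fact k"
  have diff: "abs_p (?E a K * ?E b K - ?E (a + b) K) \<le> c ^ K" for K
  proof -
    let ?g = "\<lambda>(i, j). (a ^ i / fact i) * (b ^ j / fact j)"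
    let ?T = "{(i, j). i + j < K}"
    have "(a + b) ^ k / fact k = (\<Sum>i\<le>k. ?g (i, k - i))" for k
      by (simp add: binomial_ring sum_divide_distrib binomial_fact)
    then have "?E (a + b) K = sum ?g ?T"
      using sum.triangle_reindex[of "\<lambda>i j. ?g (i, j)" K] by simp
    moreover have "?E a K * ?E b K = sum ?g ({..<K} \<times> {..<K})"
      by (simp add: sum_product sum.cartesian_product)
    moreover have "?T \<subseteq> {..<K} \<times> {..<K}"
      by auto
    ultimately have eq: "?E a K * ?E b K - ?E (a + b) K = sum ?g ({..<K} \<times> {..<K} - ?T)"
      by (simp add: sum_diff)
    show ?thesis
      unfolding eq
    proof (rule abs_sum_le)
      fix ij assume ij: "ij \<in> {..<K} \<times> {..<K} - ?T"
      obtain i j where [simp]: "ij = (i, j)"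
        by force
      have "abs_p (a ^ i / fact i) \<le> c ^ i"
        by (rule order_trans[OF abs_exp_term_le'])
           (use inv_radius_ge_1 in \<open>auto simp: c_def intro!: power_mono mult_right_mono\<close>)
      moreover have "abs_p (b ^ j / fact j) \<le> c ^ j"
        by (rule order_trans[OF abs_exp_term_le'])
           (use inv_radius_ge_1 in \<open>auto simp: c_def intro!: power_mono mult_right_mono\<close>)
      ultimately have "abs_p (a ^ i / fact i) * abs_p (b ^ j / fact j) \<le> c ^ i * c ^ j"
        using c by (intro mult_mono) auto
      then have "abs_p (?g ij) \<le> c ^ i * c ^ j"
        by (simp only: \<open>ij = (i, j)\<close> prod.case abs_mult)
      also have "\<dots> \<le> c ^ K"
        unfolding power_add[symmetric] using ij c by (intro power_decreasing) auto
      finally show "abs_p (?g ij) \<le> c ^ K" .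
    qed (use c in auto)
  qed
  have "(\<lambda>K. ?E a K * ?E b K - ?E (a + b) K) \<longlonglongrightarrow> padic_exp a * padic_exp b - padic_exp (a + b)"
    using padic_exp_sums[OF a] padic_exp_sums[OF b] padic_exp_sums[OF ab]
    unfolding sums_def by (intro padic_tendsto_intros)
  moreover have "(\<lambda>K. ?E a K * ?E b K - ?E (a + b) K) \<longlonglongrightarrow> 0"
    unfolding tendsto_iff_abs
    using diff c by (intro Lim_null_comparison[OF _ LIMSEQ_realpow_zero[of c]]) auto
  ultimately show ?thesis
    using LIMSEQ_unique by fastforce
qed

lemma small_mult:
  assumes "abs_p z * inv_radius < 1" "abs_p a \<le> 1"
  shows "abs_p (a * z) * inv_radius < 1"
proof -
  have "abs_p (a * z) \<le> abs_p z"
    using assms(2) by (simp add: abs_mult mult_left_le_one_le)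
  then show ?thesis
    using assms(1) inv_radius_ge_1 by (meson le_less_trans mult_right_mono order_trans zero_le_one)
qed

lemma padic_exp_of_nat_mult:
  assumes "abs_p z * inv_radius < 1"
  shows "padic_exp (of_nat n * z) = padic_exp z ^ n"
proof (induction n)
  case (Suc n)
  have "padic_exp (of_nat (Suc n) * z) = padic_exp (z + of_nat n * z)"
    by (simp add: algebra_simps)
  also have "\<dots> = padic_exp z * padic_exp (of_nat n * z)"
    by (intro padic_exp_add assms small_mult abs_of_nat_le)
  finally show ?case
    using Suc.IH by simp
qed auto

lemma padic_exp_uminus:
  assumes "abs_p z * inv_radius < 1"
  shows "padic_exp (- z) = inverse (padic_exp z)"
  using padic_exp_add[of z "- z"] assms by (simp add: inverse_unique)

lemma abs_padic_exp_log_diff_le: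
  assumes "abs_p (1 - r) * inv_radius < 1"
  shows "abs_p (padic_exp (padic_log r) - r) \<le> abs_p (1 - r) ^ 2 * inv_radius"
proof -
  have "abs_p (padic_log r) ^ 2 * inv_radius \<le> abs_p (1 - r) ^ 2 * inv_radius"
    using inv_radius_ge_1 abs_padic_log_le[OF assms] by (intro mult_right_mono power_mono) auto
  then have "abs_p (padic_exp (padic_log r) - (1 + padic_log r)) \<le> abs_p (1 - r) ^ 2 * inv_radius"
    using abs_padic_exp_diff_le[OF padic_log_small[OF assms]] by linarith
  then show ?thesis
    using abs_add_leI[OF _ abs_padic_log_diff_le[OF assms]] by fastforce
qed

text \<open>
  Raising \<open>w = exp (log r) / r\<close> to the power \<open>M = p\<^sup>N\<close> scales \<open>1 - w\<close> by \<open>\<bar>M\<bar>\<close>, whereas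
  \<open>exp (log s) / s\<close> at \<open>s = r\<^sup>M\<close> differs from \<open>1\<close> only to second order in \<open>\<bar>1 - s\<bar> = \<bar>M\<bar>\<bar>1 - r\<bar>\<close>.
\<close>

lemma padic_exp_log:
  assumes "abs_p (1 - r) * inv_radius < 1"
  shows "padic_exp (padic_log r) = r"
proof -
  define w where "w = padic_exp (padic_log r) * inverse r"
  have w: "abs_p (1 - w) * inv_radius < 1"
    unfolding w_def
    by (intro mult_near_1 padic_exp_near_1 padic_log_small inverse_near_1 assms)
  have bound: "abs_p (1 - w) \<le> abs_p (of_nat M) * (abs_p (1 - r) ^ 2 * inv_radius)" if "M > 0" for M
  proof -
    have "w ^ M = padic_exp (padic_log (r ^ M)) / r ^ M"
      unfolding w_def padic_log_power[OF assms]
      by (simp add: padic_exp_of_nat_mult padic_log_small assms power_mult_distrib power_inverse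
          divide_inverse)
    then have "1 - w ^ M = - (padic_exp (padic_log (r ^ M)) - r ^ M) / r ^ M"
      using near_1_nonzero[OF assms] by (simp add: field_simps)
    then have "abs_p (1 - w ^ M) = abs_p (padic_exp (padic_log (r ^ M)) - r ^ M)"
      using abs_near_1[OF power_near_1[OF assms], of M] by (simp add: abs_divide del: minus_diff_eq)
    also have "\<dots> \<le> abs_p (1 - r ^ M) ^ 2 * inv_radius"
      by (intro abs_padic_exp_log_diff_le power_near_1 assms)
    finally have "abs_p (of_nat M) * abs_p (1 - w)
        \<le> abs_p (of_nat M) * (abs_p (of_nat M) * (abs_p (1 - r) ^ 2 * inv_radius))"
      unfolding abs_power_minus_1[OF w] abs_power_minus_1[OF assms]
      by (simp add: power2_eq_square mult_ac)
    then show ?thesis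
      using that by simp
  qed
  have "(\<lambda>N. abs_p (of_nat (p ^ N)) * (abs_p (1 - r) ^ 2 * inv_radius))
      \<longlonglongrightarrow> abs_p 0 * (abs_p (1 - r) ^ 2 * inv_radius)"
    by (intro tendsto_mult tendsto_const abs_tendsto p_power_tendsto_0)
  then have "abs_p (1 - w) \<le> 0"
    using p_gt_1 by (intro Lim_bounded2[where N = 0]) (auto intro!: bound simp del: of_nat_power)
  then have "w = 1"
    using abs_nonneg[of "1 - w"] by (metis abs_eq_0_iff antisym right_minus_eq)
  then show ?thesis
    using near_1_nonzero[OF assms] by (simp add: w_def field_simps)
qed

lemma padic_power_add:
  assumes "abs_p (1 - r) * inv_radius < 1" "abs_p x \<le> 1" "abs_p y \<le> 1"
  shows "padic_power r (x + y) = padic_power r x * padic_power r y"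
  unfolding padic_power_def distrib_right
  by (intro padic_exp_add small_mult padic_log_small assms)

lemma padic_power_of_nat:
  assumes "abs_p (1 - r) * inv_radius < 1"
  shows "padic_power r (of_nat n) = r ^ n"
  by (simp add: padic_power_def padic_exp_of_nat_mult padic_log_small padic_exp_log assms)

lemma padic_power_inverse:
  assumes "abs_p (1 - r) * inv_radius < 1" "abs_p x \<le> 1"
  shows "padic_power (inverse r) x = inverse (padic_power r x)"
  by (simp add: padic_power_def padic_log_inverse padic_exp_uminus small_mult padic_log_small assms)

lemma padic_power_diff:
  assumes "abs_p (1 - r) * inv_radius < 1" "abs_p x \<le> 1" "abs_p y \<le> 1"
  shows "padic_power r (x - y) = padic_power r x / padic_power r y"
proof -
  have "padic_power r (- y) = inverse (padic_power r y)"
    by (simp add: padic_power_def padic_exp_uminus small_mult padic_log_small assms)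
  then show ?thesis
    using padic_power_add[of r x "- y"] assms by (simp add: divide_inverse)
qed

subsection \<open>The integral for \<open>q \<noteq> 1\<close>\<close>

lemma q_integral_geometric:
  assumes r: "abs_p (1 - r) * inv_radius < 1" and "r \<noteq> 1" and m: "m > 0"
  shows "1 / q_number r (of_nat (p ^ N)) * (\<Sum>y<p ^ N. (r ^ m) ^ y)
       = (1 - r) / (1 - r ^ m) * (\<Sum>j<m. (r ^ p ^ N) ^ j)"
proof -
  have "r ^ m \<noteq> 1" "r ^ p ^ N \<noteq> 1"
    using power_eq_1_iff_near_1[OF r] m p_gt_1 \<open>r \<noteq> 1\<close> by auto
  moreover have "q_number r (of_nat (p ^ N)) = (1 - r ^ p ^ N) / (1 - r)"
    using \<open>r \<noteq> 1\<close> padic_power_of_nat[OF r] by (simp add: q_number_def del: of_nat_power)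
  moreover have "(r ^ m) ^ p ^ N = (r ^ p ^ N) ^ m"
    by (metis mult.commute power_mult)
  ultimately show ?thesis
    using \<open>r \<noteq> 1\<close> by (simp add: sum_gp_strict)
qed

lemma q_integral_q_exponential:
  assumes r: "abs_p (1 - r) * inv_radius < 1" and "r \<noteq> 1"
    and f: "\<And>y :: nat. f (of_nat y) = ((1 - A * (r ^ \<alpha>) ^ y) / (1 - r ^ \<alpha>)) ^ n"
  shows "q_integral p r f
       = 1 / (1 - r ^ \<alpha>) ^ n * (\<Sum>k\<le>n. of_nat (n choose k) * (- A) ^ k *
           ((1 - r) / (1 - r ^ (1 + \<alpha> * k)) * of_nat (1 + \<alpha> * k)))"
proof -
  have expand: "f (of_nat y) * r ^ y
      = 1 / (1 - r ^ \<alpha>) ^ n * (\<Sum>k\<le>n. of_nat (n choose k) * (- A) ^ k * (r ^ (1 + \<alpha> * k)) ^ y)"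
    for y
  proof -
    have "(1 - A * (r ^ \<alpha>) ^ y) ^ n = (- A * (r ^ \<alpha>) ^ y + 1) ^ n"
      by simp
    also have "\<dots> = (\<Sum>k\<le>n. of_nat (n choose k) * (- A * (r ^ \<alpha>) ^ y) ^ k)"
      by (simp only: binomial_ring power_one mult_1_right)
    also have "\<dots> * r ^ y
        = (\<Sum>k\<le>n. of_nat (n choose k) * (- A) ^ k * (r ^ (1 + \<alpha> * k)) ^ y)"
      unfolding sum_distrib_right
    proof (rule sum.cong)
      fix k
      have "((r ^ \<alpha>) ^ y) ^ k * r ^ y = (r ^ (1 + \<alpha> * k)) ^ y"
        by (simp only: power_mult[symmetric] power_add[symmetric]) (simp add: algebra_simps)
      then show "of_nat (n choose k) * (- A * (r ^ \<alpha>) ^ y) ^ k * r ^ y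
          = of_nat (n choose k) * (- A) ^ k * (r ^ (1 + \<alpha> * k)) ^ y"
        by (simp only: power_mult_distrib mult.assoc)
    qed simp
    finally show ?thesis
      by (simp add: f power_divide)
  qed
  have "1 / q_number r (of_nat (p ^ N)) * (\<Sum>y = 0..<p ^ N. f (of_nat y) * r ^ y)
      = 1 / (1 - r ^ \<alpha>) ^ n * (\<Sum>k\<le>n. of_nat (n choose k) * (- A) ^ k *
           ((1 - r) / (1 - r ^ (1 + \<alpha> * k)) * (\<Sum>j<1 + \<alpha> * k. (r ^ p ^ N) ^ j)))" for N
  proof -
    let ?q = "1 / q_number r (of_nat (p ^ N))"
    have "?q * (\<Sum>y = 0..<p ^ N. f (of_nat y) * r ^ y)
        = 1 / (1 - r ^ \<alpha>) ^ n * (\<Sum>y<p ^ N. \<Sum>k\<le>n. of_nat (n choose k) * (- A) ^ k *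
             (?q * (r ^ (1 + \<alpha> * k)) ^ y))"
      unfolding expand atLeast0LessThan sum_distrib_left by (simp only: mult_ac)
    also have "(\<Sum>y<p ^ N. \<Sum>k\<le>n. of_nat (n choose k) * (- A) ^ k *
             (?q * (r ^ (1 + \<alpha> * k)) ^ y))
        = (\<Sum>k\<le>n. of_nat (n choose k) * (- A) ^ k * (?q * (\<Sum>y<p ^ N. (r ^ (1 + \<alpha> * k)) ^ y)))"
      unfolding sum_distrib_left by (rule sum.swap)
    finally have expanded: "?q * (\<Sum>y = 0..<p ^ N. f (of_nat y) * r ^ y)
        = 1 / (1 - r ^ \<alpha>) ^ n * (\<Sum>k\<le>n. of_nat (n choose k) * (- A) ^ k *
             (?q * (\<Sum>y<p ^ N. (r ^ (1 + \<alpha> * k)) ^ y)))" .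
    have geometric: "?q * (\<Sum>y<p ^ N. (r ^ (1 + \<alpha> * k)) ^ y)
        = (1 - r) / (1 - r ^ (1 + \<alpha> * k)) * (\<Sum>j<1 + \<alpha> * k. (r ^ p ^ N) ^ j)" for k
      by (rule q_integral_geometric[OF r \<open>r \<noteq> 1\<close>]) simp
    show ?thesis
      by (simp only: expanded geometric)
  qed
  moreover have "(\<lambda>N. 1 / (1 - r ^ \<alpha>) ^ n * (\<Sum>k\<le>n. of_nat (n choose k) * (- A) ^ k *
           ((1 - r) / (1 - r ^ (1 + \<alpha> * k)) * (\<Sum>j<1 + \<alpha> * k. (r ^ p ^ N) ^ j))))
      \<longlonglongrightarrow> 1 / (1 - r ^ \<alpha>) ^ n * (\<Sum>k\<le>n. of_nat (n choose k) * (- A) ^ k *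
           ((1 - r) / (1 - r ^ (1 + \<alpha> * k)) * (\<Sum>j<1 + \<alpha> * k. 1 ^ j)))"
    by (intro padic_tendsto_intros power_p_power_tendsto_1 r)
  ultimately show ?thesis
    unfolding q_integral_def by (intro limI) (simp del: of_nat_Suc of_nat_power)
qed

lemma weighted_q_bernoulli_reflect_q_neq_1:
  assumes q: "abs_p (1 - q) * inv_radius < 1" and "q \<noteq> 1" and "\<alpha> > 0" and x: "abs_p x \<le> 1"
  shows "weighted_q_bernoulli p \<alpha> n (inverse q) (1 - x)
       = (-1) ^ n * q ^ (\<alpha> * n) * weighted_q_bernoulli p \<alpha> n q x"
proof -
  define s where "s = q ^ \<alpha>"
  have s: "abs_p (1 - s) * inv_radius < 1"
    unfolding s_def by (rule power_near_1[OF q])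
  have "s \<noteq> 1" "s \<noteq> 0" "q \<noteq> 0"
    using power_eq_1_iff_near_1[OF q] \<open>\<alpha> > 0\<close> \<open>q \<noteq> 1\<close> near_1_nonzero[OF q] near_1_nonzero[OF s]
    by (auto simp: s_def)
  define A where "A = padic_power s x"
  have "q_number s (x + of_nat y) = (1 - A * s ^ y) / (1 - s)" for y
    using \<open>s \<noteq> 1\<close> padic_power_add[OF s x abs_of_nat_le] padic_power_of_nat[OF s]
    by (simp add: q_number_def A_def)
  then have 1: "weighted_q_bernoulli p \<alpha> n q x
      = 1 / (1 - s) ^ n * (\<Sum>k\<le>n. of_nat (n choose k) * (- A) ^ k *
           ((1 - q) / (1 - q ^ (1 + \<alpha> * k)) * of_nat (1 + \<alpha> * k)))"
    unfolding weighted_q_bernoulli_def s_def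
    by (intro q_integral_q_exponential q \<open>q \<noteq> 1\<close>) simp
  have x': "abs_p (1 - x) \<le> 1"
    using abs_diff_le[of 1 x] x by simp
  have inv: "(inverse q) ^ \<alpha> = inverse s"
    by (simp add: s_def power_inverse)
  have "q_number (inverse s) (1 - x + of_nat y)
      = (1 - A / s * inverse s ^ y) / (1 - inverse s)" for y
  proof -
    have "padic_power (inverse s) (1 - x + of_nat y)
        = padic_power (inverse s) (1 - x) * inverse s ^ y"
      using padic_power_add[OF inverse_near_1[OF s] x' abs_of_nat_le]
        padic_power_of_nat[OF inverse_near_1[OF s]] by simp
    also have "padic_power (inverse s) (1 - x) = A / s"
      using padic_power_inverse[OF s x'] padic_power_diff[OF s _ x, of 1]
        padic_power_of_nat[OF s, of 1] by (simp add: A_def)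
    finally show ?thesis
      using \<open>s \<noteq> 1\<close> by (simp add: q_number_def)
  qed
  then have 2: "weighted_q_bernoulli p \<alpha> n (inverse q) (1 - x)
      = 1 / (1 - inverse s) ^ n * (\<Sum>k\<le>n. of_nat (n choose k) * (- (A / s)) ^ k *
           ((1 - inverse q) / (1 - inverse q ^ (1 + \<alpha> * k)) * of_nat (1 + \<alpha> * k)))"
    unfolding weighted_q_bernoulli_def inv[symmetric]
    by (intro q_integral_q_exponential inverse_near_1 q) (use \<open>q \<noteq> 1\<close> in simp_all)
  have term_eq: "(- (A / s)) ^ k * ((1 - inverse q) / (1 - inverse q ^ (1 + \<alpha> * k)))
      = (- A) ^ k * ((1 - q) / (1 - q ^ (1 + \<alpha> * k)))" for k
  proof -
    have reflect: "1 - inverse z = - (1 - z) / z" if "z \<noteq> 0" for z :: 'a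
      using that by (simp add: field_simps)
    have "(1 - inverse q) / (1 - inverse q ^ (1 + \<alpha> * k))
        = (1 - q) / (1 - q ^ (1 + \<alpha> * k)) * (q ^ (1 + \<alpha> * k) / q)"
      unfolding power_inverse reflect[OF \<open>q \<noteq> 0\<close>] reflect[OF power_not_zero[OF \<open>q \<noteq> 0\<close>]]
      by (simp del: minus_diff_eq)
    also have "q ^ (1 + \<alpha> * k) / q = s ^ k"
      using \<open>q \<noteq> 0\<close> by (simp add: s_def power_mult)
    finally show ?thesis
      using \<open>s \<noteq> 0\<close> by (simp add: power_divide flip: divide_minus_left)
  qed
  have sum_eq: "(\<Sum>k\<le>n. of_nat (n choose k) * (- (A / s)) ^ k *
           ((1 - inverse q) / (1 - inverse q ^ (1 + \<alpha> * k)) * of_nat (1 + \<alpha> * k)))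
      = (\<Sum>k\<le>n. of_nat (n choose k) * (- A) ^ k *
           ((1 - q) / (1 - q ^ (1 + \<alpha> * k)) * of_nat (1 + \<alpha> * k)))"
    by (intro sum.cong refl)
       (simp only: mult.assoc[of "of_nat (n choose _)"] mult.assoc[symmetric, of "_ ^ _"] term_eq)
  have "1 / (1 - inverse s) ^ n = (-1) ^ n * s ^ n * (1 / (1 - s) ^ n)"
  proof -
    have "1 / (1 - inverse s) = - s * (1 / (1 - s))"
      using \<open>s \<noteq> 0\<close> \<open>s \<noteq> 1\<close> by (simp add: field_simps)
    then have "(1 / (1 - inverse s)) ^ n = (- 1 * s * (1 / (1 - s))) ^ n"
      by simp
    then show ?thesis
      by (simp only: power_mult_distrib power_one_over)
  qed
  then show ?thesis
    unfolding 1 2 sum_eq by (simp only: s_def power_mult mult.assoc)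
qed

subsection \<open>The integral for \<open>q = 1\<close>\<close>

text \<open>
  Telescoping \<open>(a + y) ^ Suc n\<close> gives a recursion for the power sums. The limit is taken along
  sequences \<open>a \<longlonglongrightarrow> x\<close> so that it applies to \<open>x - p\<^sup>N\<close>, which the reversal of summation produces.
\<close>

lemma power_sum_recursion:
  fixes a :: 'a
  shows "of_nat M * (\<Sum>i<Suc n. a ^ (n - i) * (a + of_nat M) ^ i)
       = (\<Sum>j\<le>n. of_nat (Suc n choose j) * (\<Sum>y<M. (a + of_nat y) ^ j))"
proof -
  have "(\<Sum>j\<le>n. of_nat (Suc n choose j) * (\<Sum>y<M. (a + of_nat y) ^ j))
      = (\<Sum>y<M. \<Sum>j\<le>n. of_nat (Suc n choose j) * (a + of_nat y) ^ j)"
    unfolding sum_distrib_left by (rule sum.swap)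
  also have "\<dots> = (\<Sum>y<M. (a + of_nat (Suc y)) ^ Suc n - (a + of_nat y) ^ Suc n)"
  proof (rule sum.cong)
    fix y
    have "(a + of_nat (Suc y)) ^ Suc n = (a + of_nat y + 1) ^ Suc n"
      by (simp add: add_ac)
    also have "\<dots> = (\<Sum>j\<le>Suc n. of_nat (Suc n choose j) * (a + of_nat y) ^ j)"
      by (simp only: binomial_ring power_one mult_1_right)
    also have "\<dots> = (\<Sum>j\<le>n. of_nat (Suc n choose j) * (a + of_nat y) ^ j) + (a + of_nat y) ^ Suc n"
      by (simp only: sum.atMost_Suc binomial_n_n of_nat_1 mult_1_left)
    finally show "(\<Sum>j\<le>n. of_nat (Suc n choose j) * (a + of_nat y) ^ j)
        = (a + of_nat (Suc y)) ^ Suc n - (a + of_nat y) ^ Suc n"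
      by (simp only: add_diff_cancel_right')
  qed simp
  also have "\<dots> = (a + of_nat M) ^ Suc n - a ^ Suc n"
    using sum_lessThan_telescope[of "\<lambda>y. (a + of_nat y) ^ Suc n" M]
    by (simp only: of_nat_0 add_0_right)
  also have "\<dots> = of_nat M * (\<Sum>i<Suc n. a ^ (n - i) * (a + of_nat M) ^ i)"
    by (simp only: power_diff_sumr2 diff_Suc_Suc add_diff_cancel_left')
  finally show ?thesis ..
qed

lemma volkenborn_power_limit:
  "\<exists>L. \<forall>a. a \<longlonglongrightarrow> x \<longrightarrow> (\<lambda>N. 1 / of_nat (p ^ N) * (\<Sum>y<p ^ N. (a N + of_nat y) ^ n)) \<longlonglongrightarrow> (L :: 'a)"
proof (induction n rule: less_induct)
  case (less n)
  define S where "S a j = (\<lambda>N. 1 / of_nat (p ^ N) * (\<Sum>y<p ^ N. (a N + of_nat y) ^ j))"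
    for a :: "nat \<Rightarrow> 'a" and j
  have "\<forall>j. \<exists>L. j < n \<longrightarrow> (\<forall>a. a \<longlonglongrightarrow> x \<longrightarrow> S a j \<longlonglongrightarrow> L)"
    unfolding S_def using less by blast
  from choice[OF this] obtain L where L: "\<And>j a. j < n \<Longrightarrow> a \<longlonglongrightarrow> x \<Longrightarrow> S a j \<longlonglongrightarrow> L j"
    by blast
  let ?L = "((\<Sum>i<Suc n. x ^ (n - i) * (x + 0) ^ i) - (\<Sum>j<n. of_nat (Suc n choose j) * L j))
    * inverse (of_nat (Suc n))"
  have "S a n \<longlonglongrightarrow> ?L" if a: "a \<longlonglongrightarrow> x" for a
  proof -
    have S_eq: "S a n N = ((\<Sum>i<Suc n. a N ^ (n - i) * (a N + of_nat (p ^ N)) ^ i)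
        - (\<Sum>j<n. of_nat (Suc n choose j) * S a j N)) * inverse (of_nat (Suc n))" for N
    proof -
      let ?M = "of_nat (p ^ N) :: 'a"
      have M: "?M \<noteq> 0"
        using p_gt_1 by simp
      have "(\<Sum>y<p ^ N. (a N + of_nat y) ^ j) = ?M * S a j N" for j
        using M by (simp add: S_def)
      then have "?M * (\<Sum>i<Suc n. a N ^ (n - i) * (a N + ?M) ^ i)
          = ?M * (\<Sum>j\<le>n. of_nat (Suc n choose j) * S a j N)"
        unfolding power_sum_recursion by (simp only: sum_distrib_left mult.left_commute)
      then have "(\<Sum>i<Suc n. a N ^ (n - i) * (a N + ?M) ^ i)
          = (\<Sum>j\<le>n. of_nat (Suc n choose j) * S a j N)"
        by (simp only: mult_left_cancel[OF M])
      also have "\<dots> = (\<Sum>j<n. of_nat (Suc n choose j) * S a j N) + of_nat (Suc n) * S a n N"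
        by (simp only: lessThan_Suc_atMost[symmetric] sum.lessThan_Suc) simp
      finally show ?thesis
        by (simp del: of_nat_Suc)
    qed
    show ?thesis
      unfolding ext[of "S a n", OF S_eq]
      by (intro padic_tendsto_intros a p_power_tendsto_0 L) auto
  qed
  then show ?case
    unfolding S_def by blast
qed

lemma weighted_q_bernoulli_reflect_1:
  "weighted_q_bernoulli p \<alpha> n 1 (1 - x) = (-1) ^ n * weighted_q_bernoulli p \<alpha> n 1 (x :: 'a)"
proof -
  let ?S = "\<lambda>a N. 1 / of_nat (p ^ N) * (\<Sum>y<p ^ N. (a N + of_nat y) ^ n)"
  obtain L where L: "\<And>a. a \<longlonglongrightarrow> x \<Longrightarrow> ?S a \<longlonglongrightarrow> L"
    using volkenborn_power_limit by blast
  have bernoulli: "weighted_q_bernoulli p \<alpha> n 1 z = lim (?S (\<lambda>_. z))" for z :: 'a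
    by (simp add: weighted_q_bernoulli_def q_integral_def q_number_def atLeast0LessThan)
  have "?S (\<lambda>_. 1 - x) N = (-1) ^ n * ?S (\<lambda>N. x - of_nat (p ^ N)) N" for N
  proof -
    have "(\<Sum>y<p ^ N. (1 - x + of_nat y) ^ n)
        = (\<Sum>y<p ^ N. (-1) ^ n * (x - of_nat (p ^ N) + of_nat (p ^ N - Suc y)) ^ n)"
    proof (rule sum.cong)
      fix y assume "y \<in> {..<p ^ N}"
      then have "of_nat (p ^ N - Suc y) = (of_nat (p ^ N) - of_nat (Suc y) :: 'a)"
        by (intro of_nat_diff) auto
      then have "1 - x + of_nat y = - 1 * (x - of_nat (p ^ N) + of_nat (p ^ N - Suc y))"
        by simp
      then show "(1 - x + of_nat y) ^ n
          = (-1) ^ n * (x - of_nat (p ^ N) + of_nat (p ^ N - Suc y)) ^ n"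
        by (simp only: power_mult_distrib)
    qed simp
    also have "\<dots> = (\<Sum>y<p ^ N. (-1) ^ n * (x - of_nat (p ^ N) + of_nat y) ^ n)"
      by (rule sum.nat_diff_reindex)
    finally show ?thesis
      by (simp only: sum_distrib_left[symmetric] mult.left_commute)
  qed
  moreover have "(\<lambda>N. (-1) ^ n * ?S (\<lambda>N. x - of_nat (p ^ N)) N) \<longlonglongrightarrow> (-1) ^ n * L"
  proof -
    have "(\<lambda>N. x - of_nat (p ^ N)) \<longlonglongrightarrow> x - 0"
      by (intro padic_tendsto_intros p_power_tendsto_0)
    then show ?thesis
      by (intro padic_tendsto_mult tendsto_const L) simp
  qed
  ultimately have "lim (?S (\<lambda>_. 1 - x)) = (-1) ^ n * L"
    by (intro limI) (simp only:)
  moreover have "lim (?S (\<lambda>_. x)) = L"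
    by (intro limI L tendsto_const)
  ultimately show ?thesis
    unfolding bernoulli by simp
qed

end

theorem theorem9:
  fixes p n \<alpha> :: nat
    and abs_p :: "'a::{field_char_0, complete_space} \<Rightarrow> real"
    and q x :: 'a
  assumes "padic_complex_field p abs_p"
    and "odd p"
    and "abs_p (1 - q) < real p powr (- 1 / (real p - 1))"
    and "\<alpha> \<ge> 1"
    and "x \<in> Zp abs_p"
  shows "weighted_q_bernoulli p \<alpha> n (inverse q) (1 - x)
       = (-1) ^ n * q ^ (\<alpha> * n) * weighted_q_bernoulli p \<alpha> n q x"
proof -
  interpret padic_complex_field p abs_p
    by fact
  have q: "abs_p (1 - q) * inv_radius < 1"
    using assms(3) by (simp only: less_radius_iff)
  have x: "abs_p x \<le> 1"
    using assms(5) by (simp add: Zp_def)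
  show ?thesis
  proof (cases "q = 1")
    case True
    then show ?thesis
      using weighted_q_bernoulli_reflect_1 by simp
  next
    case False
    then show ?thesis
      using weighted_q_bernoulli_reflect_q_neq_1[OF q _ _ x] assms(4) by simp
  qed
qed

end
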